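(* Let $T_{\min}>0$ and let $H$ be a Hilbert space. If there exist self-adjoint, strongly differentiable $\bar P_i:[0,T_{\min}]\to L(H)$, $i=1,\dots,N$, with $0\prec\bar P_i(\tau)\preceq c_PI$, and self-adjoint operators $Q_i:[0,T_{\min}]\to L(H)$, $Q_i^\infty\in L(H)$ with $Q_i(\tau)\succeq\alpha_qI$, $Q_i^\infty\succeq\alpha_q^\infty I$ ($c_P,\alpha_q,\alpha_q^\infty>0$), such that for every mode $i$ and every $j\neq i$ $$\dot{\bar P}_i(\tau)+A_i^*\bar P_i(\tau)+\bar P_i(\tau)A_i+Q_i(\tau)\preceq0,\quad\tau\in(0,T_{\min}),$$ $$A_i^*\bar P_i(T_{\min})+\bar P_i(T_{\min})A_i+Q_i^\infty\preceq0,$$ $$\bar P_j(0)\preceq\bar P_i(T_{\min})$$ (the first two inequalities holding as quadratic forms on $D(A_i)$), then the switched system $\dot x(t)=A_{\eta(t)}x(t)$ is UGES over $\Sigma_{\min}(T_{\min})$.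
   Context: Switched system. $A_1,\dots,A_N$ generate $C_0$-semigroups $S_1,\dots,S_N$ on $H$ and share a common domain $\mathcal D=D(A_1)=\dots=D(A_N)$. A switching signal $\eta:\mathbb R_{\ge0}\to\{1,\dots,N\}$ is piecewise constant and right-continuous; its discontinuities (switching instants) form a sequence $\{t_k\}_{k\ge1}$ with, setting $t_0:=0$, $t_{k+1}>t_k$ for $k\ge0$ and $t_k\to\infty$; $\eta\equiv i_k$ on $[t_k,t_{k+1})$ with $i_{k-1}\neq i_k$. $\Phi_\eta(t,s)$, $t\ge s\ge0$, is the evolution family of $\dot x=A_{\eta(t)}x$: it coincides with the active semigroup on each mode interval and is composed continuously across switches, i.e. $\Phi_\eta(t,s)=S_{i_m}(t-t_m)S_{i_{m-1}}(t_m-t_{m-1})\cdots S_{i_{l-1}}(t_l-s)$ if $t_l<\dots<t_m$ are the switching instants in $(s,t]$. $\Sigma_{\min}(T_{\min})$ is the family of switching signals whose consecutive switching instants are at least $T_{\min}$ apart. UGES over a family $\Sigma$ of signals: there exist $M\ge1$, $\alpha\ge0$, $\rho\in(0,1]$ with $\alpha-\log\rho>0$ such that $\|\Phi_\eta(t,s)\|\le M\rho^{\kappa(t,s)}e^{-\alpha(t-s)}$ for all $t\ge s\ge0$ and $\eta\in\Sigma$, where $\kappa(t,s)$ is the number of switching instants of $\eta$ in $(s,t]$. Notation: $P\succeq Q$ (resp. $P\succ Q$) means $\langle h,(P-Q)h\rangle_H\ge0$ for all $h\in H$ (resp. $>0$ for all $h\ne0$). The form of $A^*P+PA$ on $d\in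 D(A)$ is $\langle Ad,Pd\rangle_H+\langle Pd,Ad\rangle_H$. Strongly differentiable: $\tau\mapsto\bar P_i(\tau)h$ is differentiable for every $h\in H$, with derivative $\dot{\bar P}_i(\tau)h$. *)

theory Defs
  imports "HOL-Analysis.Analysis"
begin

text \<open>
  Hilbert spaces are types of sort \<open>{real_inner, complete_space}\<close>, and \<open>L(H)\<close> is the type
  \<open>'h \<Rightarrow>\<^sub>L 'h\<close>.  A complex Hilbert space is an instance through its underlying real Hilbert
  space, with the real part of the complex inner product as inner product: norms, semigroups,
  generators and domains do not change, a complex linear operator is self-adjoint for one inner
  product iff it is for the other, and all quadratic forms below, being real valued on the complex
  space, keep their values.
\<close>

section \<open>Operators and quadratic forms\<close>

definition self_adjoint :: "('h::real_inner \<Rightarrow>\<^sub>L 'h) \<Rightarrow> bool" where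
  "self_adjoint P \<longleftrightarrow> (\<forall>x y. P x \<bullet> y = x \<bullet> P y)"

definition op_le :: "('h::real_inner \<Rightarrow>\<^sub>L 'h) \<Rightarrow> ('h \<Rightarrow>\<^sub>L 'h) \<Rightarrow> bool"
    (infix "\<preceq>" 50) where
  "Q \<preceq> P \<longleftrightarrow> (\<forall>h. 0 \<le> h \<bullet> (P - Q) h)"

definition op_less :: "('h::real_inner \<Rightarrow>\<^sub>L 'h) \<Rightarrow> ('h \<Rightarrow>\<^sub>L 'h) \<Rightarrow> bool"
    (infix "\<prec>" 50) where
  "Q \<prec> P \<longleftrightarrow> (\<forall>h. h \<noteq> 0 \<longrightarrow> 0 < h \<bullet> (P - Q) h)"

text \<open>The quadratic form of \<open>A\<^sup>*P + PA\<close>, meaningful for \<open>d\<close> in the domain of the (unbounded)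
  operator \<open>A\<close>.\<close>

definition lyapunov_form :: "('h::real_inner \<Rightarrow> 'h) \<Rightarrow> ('h \<Rightarrow>\<^sub>L 'h) \<Rightarrow> 'h \<Rightarrow> real" where
  "lyapunov_form A P d = A d \<bullet> P d + P d \<bullet> A d"

text \<open>The derivative is one-sided at boundary points of \<open>I\<close>.\<close>

definition has_strong_derivative_on ::
    "(real \<Rightarrow> 'h::real_normed_vector \<Rightarrow>\<^sub>L 'h) \<Rightarrow> (real \<Rightarrow> 'h \<Rightarrow> 'h) \<Rightarrow> real set \<Rightarrow> bool" where
  "has_strong_derivative_on P P' I \<longleftrightarrow>
     (\<forall>h. \<forall>\<tau>\<in>I. ((\<lambda>\<sigma>. P \<sigma> h) has_vector_derivative P' \<tau> h) (at \<tau> within I))"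

section \<open>Semigroups and generators\<close>

text \<open>Only the values \<open>S t\<close> with \<open>t \<ge> 0\<close> matter.\<close>

definition C0_semigroup :: "(real \<Rightarrow> 'h::real_normed_vector \<Rightarrow>\<^sub>L 'h) \<Rightarrow> bool" where
  "C0_semigroup S \<longleftrightarrow>
     S 0 = id_blinfun \<and>
     (\<forall>s\<ge>0. \<forall>t\<ge>0. S (s + t) = S s o\<^sub>L S t) \<and>
     (\<forall>x. continuous_on {0..} (\<lambda>t. S t x))"

text \<open>\<open>A\<close> with domain \<open>D\<close> is the infinitesimal generator of \<open>S\<close>; the values of \<open>A\<close>
  outside \<open>D\<close> are irrelevant.\<close>

definition generates ::
    "('h::real_normed_vector \<Rightarrow> 'h) \<Rightarrow> 'h set \<Rightarrow> (real \<Rightarrow> 'h \<Rightarrow>\<^sub>L 'h) \<Rightarrow> bool" where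
  "generates A D S \<longleftrightarrow>
     C0_semigroup S \<and>
     D = {x. \<exists>y. ((\<lambda>t. (S t x - x) /\<^sub>R t) \<longlongrightarrow> y) (at_right 0)} \<and>
     (\<forall>x\<in>D. ((\<lambda>t. (S t x - x) /\<^sub>R t) \<longlongrightarrow> A x) (at_right 0))"

section \<open>Switching signals and the evolution family\<close>

text \<open>Discontinuities on the half-line; \<^typ>\<open>nat\<close> carries the discrete topology.\<close>

definition switching_instants :: "(real \<Rightarrow> nat) \<Rightarrow> real set" where
  "switching_instants \<eta> = {r. 0 \<le> r \<and> \<not> continuous (at r within {0..}) \<eta>}"

text \<open>\<open>t 0 = 0\<close> is the initial time and not a switching instant, and \<open>\<eta> (t k)\<close> is the mode
  \<open>i\<^sub>k\<close> active on \<open>[t k, t (k+1))\<close>.\<close>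

definition switching_sequence :: "nat \<Rightarrow> (real \<Rightarrow> nat) \<Rightarrow> (nat \<Rightarrow> real) \<Rightarrow> bool" where
  "switching_sequence N \<eta> t \<longleftrightarrow>
     t 0 = 0 \<and> (\<forall>k. t k < t (Suc k)) \<and> filterlim t at_top sequentially \<and>
     switching_instants \<eta> = t ` {1..} \<and>
     (\<forall>k. \<eta> (t k) \<in> {1..N}) \<and>
     (\<forall>k. \<forall>r\<in>{t k..<t (Suc k)}. \<eta> r = \<eta> (t k)) \<and>
     (\<forall>k. \<eta> (t (Suc k)) \<noteq> \<eta> (t k))"

text \<open>The first switching instant \<open>t 1\<close> may be smaller than \<open>T\<close>.\<close>

definition Sigma_min :: "nat \<Rightarrow> real \<Rightarrow> (real \<Rightarrow> nat) set" where
  "Sigma_min N T = {\<eta>. \<exists>t. switching_sequence N \<eta> t \<and> (\<forall>k\<ge>1. T \<le> t (Suc k) - t k)}"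

definition num_switches :: "(real \<Rightarrow> nat) \<Rightarrow> real \<Rightarrow> real \<Rightarrow> nat" where
  "num_switches \<eta> t s = card (switching_instants \<eta> \<inter> {s<..t})"

text \<open>Flow from time \<open>s\<close> to time \<open>t\<close> when the list contains, in increasing order, the switching
  instants in \<open>(s, t]\<close>.\<close>

fun flow_along ::
    "(nat \<Rightarrow> real \<Rightarrow> 'h::real_normed_vector \<Rightarrow>\<^sub>L 'h) \<Rightarrow> (real \<Rightarrow> nat) \<Rightarrow> real \<Rightarrow> real list \<Rightarrow> real
      \<Rightarrow> 'h \<Rightarrow>\<^sub>L 'h" where
  "flow_along S \<eta> s [] t = S (\<eta> s) (t - s)"
| "flow_along S \<eta> s (r # rs) t = flow_along S \<eta> r rs t o\<^sub>L S (\<eta> s) (r - s)"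

definition evolution ::
    "(nat \<Rightarrow> real \<Rightarrow> 'h::real_normed_vector \<Rightarrow>\<^sub>L 'h) \<Rightarrow> (real \<Rightarrow> nat) \<Rightarrow> real \<Rightarrow> real
      \<Rightarrow> 'h \<Rightarrow>\<^sub>L 'h" where
  "evolution S \<eta> t s =
     flow_along S \<eta> s (sorted_list_of_set (switching_instants \<eta> \<inter> {s<..t})) t"

definition UGES ::
    "(nat \<Rightarrow> real \<Rightarrow> 'h::real_normed_vector \<Rightarrow>\<^sub>L 'h) \<Rightarrow> (real \<Rightarrow> nat) set \<Rightarrow> bool" where
  "UGES S \<Sigma> \<longleftrightarrow>
     (\<exists>M \<alpha> \<rho> :: real. 1 \<le> M \<and> 0 \<le> \<alpha> \<and> 0 < \<rho> \<and> \<rho> \<le> 1 \<and> 0 < \<alpha> - ln \<rho> \<and>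
       (\<forall>\<eta>\<in>\<Sigma>. \<forall>s t. 0 \<le> s \<and> s \<le> t \<longrightarrow>
          norm (evolution S \<eta> t s) \<le> M * \<rho> ^ num_switches \<eta> t s * exp (- \<alpha> * (t - s))))"

end

theory Submission
  imports Defs
begin

text \<open>
  Follow the quadratic form \<open>V\<close> along a trajectory: it takes \<open>P i\<close>, for the active mode \<open>i\<close>,
  at the time elapsed since the last switch, stopped at \<open>T\<close>.  The differential inequality makes
  \<open>V\<close> dissipate while the clock runs, the holding inequality once the clock has stopped, and a
  dwell time of at least \<open>T\<close> means that the clock stands at \<open>T\<close> when the next switch comes, so the
  jump inequality keeps \<open>V\<close> from growing there.  The initial mode may last less than \<open>T\<close>; its
  clock is stopped at \<open>T\<close> from the start.  In sum (\<open>clocked_decrease\<close> on one mode interval,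
  \<open>interval_induct\<close> across the switches): as long as an orbit has norm at least \<open>\<delta>\<close>, \<open>V\<close>
  decreases at rate at least \<open>a \<delta>\<^sup>2\<close>, with \<open>a\<close> the smaller of the two lower bounds on the operators
  \<open>Q\<close>.

  The form is bounded above by \<open>c_P\<close> times the square of the norm but need not have such a bound below, so
  the decay of \<open>V\<close> says nothing directly about the norm.  The argument of Datko's theorem
  (\<open>dissipative_evolution.exponential_decay\<close>) closes the gap.  By the uniform boundedness
  principle the finitely many semigroups are bounded on \<open>[0, T]\<close>, and a window of length \<open>T\<close>
  contains at most one switch, so the evolution over such a window is bounded uniformly in the
  signal.  Hence an orbit that is large at some time, later than \<open>T\<close> after its start, was large
  during the whole window before, which costs dissipation: this bounds the orbit by its initial
  value.  Now an orbit that is not small at a late time was not small at any earlier time, and the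
  dissipation over a long stretch would exceed what \<open>V\<close> had at the start: this halves the norm
  after a fixed time.  All constants depend on \<open>c_P\<close>, \<open>a\<close>, \<open>T\<close> and the bound on the semigroups only, and UGES holds with factor
  \<open>\<rho> = 1\<close> per switch.

  Differentiating \<open>V\<close> requires orbits in the common domain \<open>D\<close>, which is invariant
  (\<open>generator_orbit\<close>) and dense (\<open>generator_domain_dense\<close>); estimates on \<open>D\<close> therefore are
  estimates of operator norms.
\<close>

section \<open>Uniform boundedness and strong limits\<close>

text \<open>The sets of points where all operators are bounded by \<open>n\<close> are closed and cover the space, so by
  Baire one of them contains a ball.\<close>
lemma uniform_boundedness:
  fixes F :: "('a::{real_normed_vector, complete_space} \<Rightarrow>\<^sub>L 'b::real_normed_vector) set"
  assumes pointwise: "\<And>x. \<exists>c. \<forall>f\<in>F. norm (f x) \<le> c"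
  shows "\<exists>C. \<forall>f\<in>F. norm f \<le> C"
proof -
  define G where "G n = {x. \<forall>f\<in>F. norm (f x) \<le> real n}" for n
  have closed_G: "closed (G n)" for n
  proof -
    have "G n = (\<Inter>f\<in>F. {x. norm (blinfun_apply f x) \<le> real n})" by (auto simp: G_def)
    moreover have "closed {x. norm (blinfun_apply f x) \<le> real n}" for f :: "'a \<Rightarrow>\<^sub>L 'b"
      by (intro closed_Collect_le continuous_intros)
    ultimately show ?thesis by (simp add: closed_INT)
  qed
  have cover: "\<Union> (range G) = UNIV"
  proof -
    have "\<exists>n. x \<in> G n" for x
    proof -
      obtain c where "\<forall>f\<in>F. norm (f x) \<le> c" using pointwise by blast
      moreover obtain n where "c \<le> real n" using real_arch_simple by blast
      ultimately show ?thesis unfolding G_def using order_trans by blast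
    qed
    then show ?thesis by blast
  qed
  have "\<exists>n. interior (G n) \<noteq> {}"
  proof (rule ccontr)
    assume "\<not> ?thesis"
    then have meagre: "\<And>X. X \<in> range G \<Longrightarrow> closedin euclidean X \<and> euclidean interior_of X = {}"
      using closed_G by (metis closed_closedin imageE euclidean_interior_of)
    have "euclidean interior_of \<Union> (range G) = {}"
    proof (rule Baire_category_alt)
      show "completely_metrizable_space (euclidean :: 'a topology) \<or>
          locally_compact_space (euclidean :: 'a topology) \<and> regular_space (euclidean :: 'a topology)"
        by (rule disjI1) (rule completely_metrizable_space_euclidean)
    qed (use meagre in simp_all)
    then show False by (simp add: cover)
  qed
  then obtain n a where "a \<in> interior (G n)" by blast
  then obtain e where e: "e > 0" "cball a e \<subseteq> G n"
    unfolding mem_interior_cball by blast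
  have "norm f \<le> 2 * real n / e" if f: "f \<in> F" for f
  proof (rule norm_blinfun_bound)
    show "0 \<le> 2 * real n / e" using e by simp
    fix x
    show "norm (f x) \<le> 2 * real n / e * norm x"
    proof (cases "x = 0")
      case False
      define y where "y = (e / norm x) *\<^sub>R x"
      have "norm y = e" using False e by (simp add: y_def)
      then have "a + y \<in> G n" "a \<in> G n" using e by (auto simp: dist_norm)
      then have "norm (f (a + y)) \<le> n" "norm (f a) \<le> n" using f by (auto simp: G_def)
      moreover have "f y = f (a + y) - f a" by (simp add: blinfun.add_right)
      ultimately have "norm (f y) \<le> 2 * real n"
        using norm_triangle_ineq4[of "f (a + y)" "f a"] by simp
      moreover have "norm (f y) = e / norm x * norm (f x)"
        using e by (simp add: y_def blinfun.scaleR_right)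
      ultimately show ?thesis using e False by (simp add: field_simps)
    qed simp
  qed
  then show ?thesis by blast
qed

text \<open>Strong convergence is only pointwise; a bound on the norms makes up for the moving argument.\<close>
lemma tendsto_strong_apply:
  fixes B :: "'i \<Rightarrow> 'a::real_normed_vector \<Rightarrow>\<^sub>L 'b::real_normed_vector"
  assumes bounded: "\<forall>\<^sub>F i in F. norm (B i) \<le> c"
    and strong: "((\<lambda>i. B i y) \<longlongrightarrow> z) F" and arg: "(f \<longlongrightarrow> y) F"
  shows "((\<lambda>i. B i (f i)) \<longlongrightarrow> z) F"
proof -
  have "((\<lambda>i. c * norm (f i - y)) \<longlongrightarrow> 0) F"
    using tendsto_mult_right_zero[OF tendsto_norm_zero[OF LIM_zero[OF arg]], of c] .
  moreover have "\<forall>\<^sub>F i in F. norm (B i (f i - y)) \<le> c * norm (f i - y)"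
    using bounded
  proof eventually_elim
    case (elim i)
    then show ?case
      using norm_blinfun[of "B i" "f i - y"] mult_right_mono[OF elim norm_ge_zero[of "f i - y"]]
      by linarith
  qed
  ultimately have "((\<lambda>i. B i (f i - y)) \<longlongrightarrow> 0) F"
    by (rule Lim_null_comparison[rotated])
  from tendsto_add[OF this strong] show ?thesis
    by (simp add: blinfun.diff_right)
qed

lemma has_vector_derivative_iff_slope:
  fixes f :: "real \<Rightarrow> 'a::real_normed_vector"
  shows "(f has_vector_derivative f') (at t within S) \<longleftrightarrow>
    ((\<lambda>r. (f r - f t) /\<^sub>R (r - t)) \<longlongrightarrow> f') (at t within S)"
proof -
  have *: "norm ((f r - f t - (r - t) *\<^sub>R f') /\<^sub>R norm (r - t)) = norm ((f r - f t) /\<^sub>R (r - t) - f')"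
    if "r \<noteq> t" for r
  proof -
    have "(f r - f t) /\<^sub>R (r - t) - f' = (f r - f t - (r - t) *\<^sub>R f') /\<^sub>R (r - t)"
      using that by (simp add: scaleR_diff_right)
    then show ?thesis by simp
  qed
  have "((\<lambda>r. (f r - f t - (r - t) *\<^sub>R f') /\<^sub>R norm (r - t)) \<longlongrightarrow> 0) (at t within S) \<longleftrightarrow>
        ((\<lambda>r. (f r - f t) /\<^sub>R (r - t) - f') \<longlongrightarrow> 0) (at t within S)"
    unfolding tendsto_norm_zero_iff[symmetric, where f = "\<lambda>r. (f r - f t - (r - t) *\<^sub>R f') /\<^sub>R norm (r - t)"]
      tendsto_norm_zero_iff[symmetric, where f = "\<lambda>r. (f r - f t) /\<^sub>R (r - t) - f'"]
    by (intro Lim_cong_within refl *)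
  then show ?thesis
    unfolding has_vector_derivative_def has_derivative_within LIM_zero_iff
    by (simp add: bounded_linear_scaleR_left diff_diff_eq inverse_eq_divide)
qed

text \<open>The product rule when \<open>B\<close> is differentiable in the strong sense only.  The difference quotient
  splits into that of \<open>B\<close> at the fixed vector \<open>y t\<close> and \<open>B r\<close> applied to that of \<open>y\<close>; the latter
  converges by the bound on \<open>B\<close>.\<close>
lemma has_vector_derivative_strong_apply:
  fixes B :: "real \<Rightarrow> 'a::real_normed_vector \<Rightarrow>\<^sub>L 'b::real_normed_vector"
  assumes bounded: "\<And>r. r \<in> I \<Longrightarrow> norm (B r) \<le> c"
    and B: "((\<lambda>r. B r (y t)) has_vector_derivative B') (at t within I)"
    and y: "(y has_vector_derivative y') (at t within I)"
    and cont: "((\<lambda>r. B r y') \<longlongrightarrow> B t y') (at t within I)"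
  shows "((\<lambda>r. B r (y r)) has_vector_derivative B' + B t y') (at t within I)"
proof -
  have "\<forall>\<^sub>F r in at t within I. norm (B r) \<le> c"
    using bounded by (auto simp: eventually_at_filter)
  from tendsto_strong_apply[OF this cont y[unfolded has_vector_derivative_iff_slope]]
  have "((\<lambda>r. (B r (y t) - B t (y t)) /\<^sub>R (r - t) + B r ((y r - y t) /\<^sub>R (r - t))) \<longlongrightarrow> B' + B t y')
      (at t within I)"
    using B[unfolded has_vector_derivative_iff_slope] by (intro tendsto_add)
  then show ?thesis
    unfolding has_vector_derivative_iff_slope
    by (simp add: blinfun.scaleR_right blinfun.diff_right scaleR_diff_right)
qed

section \<open>Orbits of a strongly continuous semigroup\<close>

lemma C0_semigroup_bounded:
  fixes S :: "real \<Rightarrow> 'a::{real_normed_vector, complete_space} \<Rightarrow>\<^sub>L 'a"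
  assumes "C0_semigroup S"
  shows "\<exists>M. \<forall>t\<in>{0..b}. norm (S t) \<le> M"
proof -
  have "\<exists>C. \<forall>f\<in>S ` {0..b}. norm f \<le> C"
  proof (rule uniform_boundedness)
    fix x
    have "continuous_on {0..b} (\<lambda>t. S t x)"
      using assms continuous_on_subset[of "{0..}" _ "{0..b}"] by (auto simp: C0_semigroup_def)
    then have "bounded ((\<lambda>t. S t x) ` {0..b})"
      by (intro compact_imp_bounded compact_continuous_image) simp_all
    then show "\<exists>c. \<forall>f\<in>S ` {0..b}. norm (f x) \<le> c"
      by (auto simp: bounded_iff)
  qed
  then show ?thesis by auto
qed

text \<open>The Riemann sums lie in the subspace.\<close>
lemma integral_in_closed_subspace:
  fixes f :: "'n::euclidean_space \<Rightarrow> 'b::real_normed_vector"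
  assumes f: "(f has_integral y) (cbox a b)"
    and R: "closed R" "subspace R" "\<And>x. f x \<in> R"
  shows "y \<in> R"
proof -
  have "\<exists>z\<in>R. dist z y < e" if e: "e > 0" for e
  proof -
    have "\<exists>\<gamma>. gauge \<gamma> \<and> (\<forall>\<D>. \<D> tagged_division_of cbox a b \<and> \<gamma> fine \<D> \<longrightarrow>
        norm ((\<Sum>(x,k)\<in>\<D>. measure lborel k *\<^sub>R f x) - y) < e)"
      using f[unfolded has_integral, rule_format, OF e] .
    then obtain \<gamma> where \<gamma>: "gauge \<gamma>" "\<And>\<D>. \<D> tagged_division_of cbox a b \<Longrightarrow> \<gamma> fine \<D> \<Longrightarrow>
        norm ((\<Sum>(x,k)\<in>\<D>. measure lborel k *\<^sub>R f x) - y) < e"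
      by meson
    obtain \<D> where \<D>: "\<D> tagged_division_of cbox a b" "\<gamma> fine \<D>"
      using fine_division_exists[OF \<gamma>(1)] .
    have "(\<Sum>(x,k)\<in>\<D>. measure lborel k *\<^sub>R f x) \<in> R"
      by (rule subspace_sum[OF R(2)]) (simp add: case_prod_unfold R subspace_scale)
    then show ?thesis using \<gamma>(2)[OF \<D>] by (intro bexI) (simp_all add: dist_norm)
  qed
  then have "y \<in> closure R" unfolding closure_approachable by blast
  then show ?thesis using R by simp
qed

text \<open>The sort of \<open>'a\<close> does not entail the class \<^class>\<open>banach\<close>, over which continuous functions are
  integrated.  The dual space is a type of that class, and \<open>'a\<close> embeds into it isometrically by
  \<open>y \<mapsto> (\<lambda>x. x \<bullet> y)\<close>.  The range is complete, hence closed, so the integral of the embedded function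
  stays in it and can be pulled back.\<close>
lemma continuous_antiderivative_exists:
  fixes f :: "real \<Rightarrow> 'a::{real_inner, complete_space}"
  assumes f: "continuous_on {a..b} f"
  shows "\<exists>F. \<forall>t\<in>{a..b}. (F has_vector_derivative f t) (at t within {a..b})"
proof -
  define J where "J = (blinfun_inner_left :: 'a \<Rightarrow> 'a \<Rightarrow>\<^sub>L real)"
  define G where "G = (\<lambda>u. integral {a..u} (\<lambda>t. J (f t)))"
  have J: "bounded_linear J" unfolding J_def by (rule bounded_linear_blinfun_inner_left)
  have J_diff: "J (x - y) = J x - J y" for x y using J by (rule linear_diff[OF bounded_linear.linear])
  have J_scale: "J (r *\<^sub>R x) = r *\<^sub>R J x" for r x
    using J by (rule linear_scale[OF bounded_linear.linear])
  have J_norm: "norm (J y) = norm y" for y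
  proof (rule antisym)
    show "norm (J y) \<le> norm y"
      by (rule norm_blinfun_bound) (use Cauchy_Schwarz_ineq2[of _ y] in \<open>auto simp: J_def mult.commute\<close>)
    have "norm (J y y) \<le> norm (J y) * norm y" by (rule norm_blinfun)
    then have "norm y * norm y \<le> norm (J y) * norm y"
      by (simp add: J_def dot_square_norm power2_eq_square)
    then show "norm y \<le> norm (J y)"
      by (cases "norm y = 0") auto
  qed
  have "complete (range J)"
    by (rule complete_isometric_image[of 1]) (use J complete_UNIV J_norm in auto)
  then have closed: "closed (range J)" by (rule complete_imp_closed)
  have sub: "subspace (range J)"
    by (rule linear_subspace_image[OF bounded_linear.linear[OF J] subspace_UNIV])
  have cont: "continuous_on {a..b} (\<lambda>t. J (f t))"
    using bounded_linear.continuous_on[OF J f] .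
  have G_range: "G u \<in> range J" if "u \<in> {a..b}" for u
  proof (rule integral_in_closed_subspace[OF _ closed sub])
    have "(\<lambda>t. J (f t)) integrable_on {a..u}"
      using that by (intro integrable_continuous_real continuous_on_subset[OF cont]) auto
    then show "((\<lambda>t. J (f t)) has_integral G u) (cbox a u)"
      unfolding G_def by (simp add: integrable_integral)
  qed auto
  define F where "F u = inv J (G u)" for u
  have JF: "J (F u) = G u" if "u \<in> {a..b}" for u
    unfolding F_def using G_range[OF that] by (simp add: f_inv_into_f)
  have "(F has_vector_derivative f t) (at t within {a..b})" if t: "t \<in> {a..b}" for t
  proof -
    have "(G has_vector_derivative J (f t)) (at t within {a..b})"
      unfolding G_def by (rule integral_has_vector_derivative[OF cont t])
    then have "((\<lambda>r. norm ((G r - G t) /\<^sub>R (r - t) - J (f t))) \<longlongrightarrow> 0) (at t within {a..b})"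
      unfolding has_vector_derivative_iff_slope
      by (intro tendsto_norm_zero LIM_zero)
    also have "?this \<longleftrightarrow> ((\<lambda>r. norm ((F r - F t) /\<^sub>R (r - t) - f t)) \<longlongrightarrow> 0) (at t within {a..b})"
    proof (rule Lim_cong_within)
      fix r assume "r \<in> {a..b}"
      then have "(G r - G t) /\<^sub>R (r - t) - J (f t) = J ((F r - F t) /\<^sub>R (r - t) - f t)"
        using t by (simp add: J_diff J_scale JF)
      then show "norm ((G r - G t) /\<^sub>R (r - t) - J (f t)) = norm ((F r - F t) /\<^sub>R (r - t) - f t)"
        by (simp add: J_norm)
    qed auto
    finally show ?thesis
      by (simp only: has_vector_derivative_iff_slope tendsto_norm_zero_iff LIM_zero_iff)
  qed
  then show ?thesis by blast
qed

text \<open>If \<open>F\<close> is an antiderivative of the orbit of \<open>x\<close>, the averages \<open>(F t - F 0) / t\<close> converge to \<open>x\<close>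
  as \<open>t\<close> tends to 0, and they lie in the domain: applying \<open>S s\<close> to \<open>F t - F 0\<close> translates the
  interval of integration, so the difference quotient at \<open>s\<close> only sees the two ends of it.\<close>
lemma generator_domain_dense:
  fixes S :: "real \<Rightarrow> 'a::{real_inner, complete_space} \<Rightarrow>\<^sub>L 'a"
  assumes gen: "generates A D S"
  shows "closure D = UNIV"
proof -
  have S0: "S 0 = id_blinfun"
    and S_add: "\<And>s t. 0 \<le> s \<Longrightarrow> 0 \<le> t \<Longrightarrow> S (s + t) = S s o\<^sub>L S t"
    and S_cont: "\<And>x. continuous_on {0..} (\<lambda>t. S t x)"
    and D: "D = {x. \<exists>y. ((\<lambda>t. (S t x - x) /\<^sub>R t) \<longlongrightarrow> y) (at_right 0)}"
    using gen by (auto simp: generates_def C0_semigroup_def)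
  have "x \<in> closure D" for x
  proof -
    have "continuous_on {0..1} (\<lambda>t. S t x)"
      using S_cont by (rule continuous_on_subset) auto
    then obtain F where F: "\<And>t. t \<in> {0..1} \<Longrightarrow> (F has_vector_derivative S t x) (at t within {0..1})"
      using continuous_antiderivative_exists by blast
    \<comment> \<open>Both sides vanish at \<open>t = 0\<close> and have the same derivative in \<open>t\<close>.\<close>
    have shift: "S s (F t - F 0) = F (s + t) - F s" if st: "0 \<le> s" "0 \<le> t" "s + t \<le> 1" for s t
    proof -
      have "((\<lambda>u. S s (F u) - F (s + u)) has_vector_derivative 0) (at u within {0..t})"
        if u: "u \<in> {0..t}" for u
      proof -
        have "(F has_vector_derivative S u x) (at u within {0..t})"
          using F[of u] u st by (auto intro: has_vector_derivative_within_subset)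
        then have 1: "((\<lambda>u. S s (F u)) has_vector_derivative S s (S u x)) (at u within {0..t})"
          by (rule bounded_linear.has_vector_derivative[OF blinfun.bounded_linear_right])
        have "(F has_vector_derivative S (s + u) x) (at (s + u) within (\<lambda>u. s + u) ` {0..t})"
          by (rule has_vector_derivative_within_subset[OF F]) (use u st in auto)
        then have "((F \<circ> (\<lambda>u. s + u)) has_vector_derivative 1 *\<^sub>R S (s + u) x) (at u within {0..t})"
          by (rule vector_diff_chain_within[rotated]) (auto intro!: derivative_eq_intros)
        from has_vector_derivative_diff[OF 1 this] show ?thesis
          using u st by (simp add: S_add o_def)
      qed
      then obtain c where "\<And>u. u \<in> {0..t} \<Longrightarrow> S s (F u) - F (s + u) = c"
        using has_vector_derivative_zero_constant[of "{0..t}"] by blast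
      from this[of 0] this[of t] show ?thesis
        using st by (simp add: blinfun.diff_right algebra_simps)
    qed
    have slope0: "((\<lambda>t. (F t - F 0) /\<^sub>R t) \<longlongrightarrow> x) (at_right 0)"
      using F[of 0] unfolding has_vector_derivative_iff_slope
      by (simp add: at_within_Icc_at_right S0)
    have in_D: "(F t - F 0) /\<^sub>R t \<in> D" if t: "0 < t" "t < 1" for t
    proof -
      have "(F has_vector_derivative S t x) (at t)"
        using F[of t] t by (simp add: at_within_Icc_at)
      then have "((\<lambda>r. (F r - F t) /\<^sub>R (r - t)) \<longlongrightarrow> S t x) (at_right t)"
        unfolding has_vector_derivative_iff_slope
        by (rule tendsto_mono[rotated]) (simp add: at_le)
      then have "((\<lambda>s. (F (s + t) - F t) /\<^sub>R s) \<longlongrightarrow> S t x) (at_right 0)"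
        by (simp add: filterlim_at_right_to_0[of _ _ t])
      from tendsto_scaleR[OF tendsto_const tendsto_diff[OF this slope0], of "inverse t"]
      have lim: "((\<lambda>s. ((F (s + t) - F t) /\<^sub>R s - (F s - F 0) /\<^sub>R s) /\<^sub>R t) \<longlongrightarrow> (S t x - x) /\<^sub>R t)
        (at_right 0)" .
      have "\<forall>\<^sub>F s in at_right 0. ((F (s + t) - F t) /\<^sub>R s - (F s - F 0) /\<^sub>R s) /\<^sub>R t
          = (S s ((F t - F 0) /\<^sub>R t) - (F t - F 0) /\<^sub>R t) /\<^sub>R s"
      proof (rule eventually_at_rightI)
        fix s assume "s \<in> {0<..<1 - t}"
        then have "S s (F t - F 0) = F (s + t) - F s" using t by (intro shift) auto
        then have flow: "S s ((F t - F 0) /\<^sub>R t) = (F (s + t) - F s) /\<^sub>R t"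
          by (simp add: blinfun.scaleR_right)
        show "((F (s + t) - F t) /\<^sub>R s - (F s - F 0) /\<^sub>R s) /\<^sub>R t
          = (S s ((F t - F 0) /\<^sub>R t) - (F t - F 0) /\<^sub>R t) /\<^sub>R s"
          unfolding flow by (simp add: algebra_simps)
      qed (use t in simp)
      from tendsto_cong[THEN iffD1, OF this lim] show ?thesis
        unfolding D by blast
    qed
    have "\<forall>\<^sub>F t in at_right 0. (F t - F 0) /\<^sub>R t \<in> closure D"
      using in_D closure_subset by (intro eventually_at_rightI[of 0 1]) auto
    then show ?thesis
      using Lim_in_closed_set[OF closed_closure _ _ slope0] by simp
  qed
  then show ?thesis by blast
qed

text \<open>\<open>S t\<close> commutes with the difference quotients of \<open>S\<close> at \<open>x\<close>, which gives invariance and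
  \<open>A (S t x) = S t (A x)\<close>.\<close>
lemma generator_orbit:
  fixes S :: "real \<Rightarrow> 'a::{real_normed_vector, complete_space} \<Rightarrow>\<^sub>L 'a"
  assumes gen: "generates A D S" and x: "x \<in> D" and t: "0 \<le> t"
  shows "S t x \<in> D"
    and "((\<lambda>r. S r x) has_vector_derivative A (S t x)) (at t within {0..})"
proof -
  have S_add: "\<And>s t. 0 \<le> s \<Longrightarrow> 0 \<le> t \<Longrightarrow> S (s + t) = S s o\<^sub>L S t"
    and S_cont: "\<And>x. continuous_on {0..} (\<lambda>t. S t x)"
    and D: "D = {x. \<exists>y. ((\<lambda>t. (S t x - x) /\<^sub>R t) \<longlongrightarrow> y) (at_right 0)}"
    and A: "\<And>x. x \<in> D \<Longrightarrow> ((\<lambda>t. (S t x - x) /\<^sub>R t) \<longlongrightarrow> A x) (at_right 0)"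
    using gen by (auto simp: generates_def C0_semigroup_def)
  have lim: "((\<lambda>h. (S h (S t x) - S t x) /\<^sub>R h) \<longlongrightarrow> S t (A x)) (at_right 0)"
  proof -
    have "((\<lambda>h. S t ((S h x - x) /\<^sub>R h)) \<longlongrightarrow> S t (A x)) (at_right 0)"
      using A[OF x] by (intro tendsto_intros)
    moreover have "\<forall>\<^sub>F h in at_right 0. S t ((S h x - x) /\<^sub>R h) = (S h (S t x) - S t x) /\<^sub>R h"
      using eventually_at_right_less
    proof eventually_elim
      case (elim h)
      have "S t (S h x) = S h (S t x)"
        using S_add[of t h] S_add[of h t] t elim
        by (simp add: add.commute flip: blinfun_apply_blinfun_compose)
      then show ?case by (simp add: blinfun.scaleR_right blinfun.diff_right)
    qed
    ultimately show ?thesis by (rule tendsto_cong[THEN iffD1, rotated])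
  qed
  then show D_inv: "S t x \<in> D" unfolding D by blast
  have A_eq: "A (S t x) = S t (A x)"
    using tendsto_unique[OF trivial_limit_at_right_real A[OF D_inv] lim] .
  obtain M where M: "\<forall>t\<in>{0..t}. norm (S t) \<le> M"
    using C0_semigroup_bounded gen unfolding generates_def by blast
  \<comment> \<open>The difference quotient between \<open>r\<close> and \<open>t\<close> is the one at 0 with step \<open>\<bar>r - t\<bar>\<close>, moved forward to
    the earlier of the two times; this treats the left and the right derivative at once.\<close>
  have "((\<lambda>r. S (min r t) ((S \<bar>r - t\<bar> x - x) /\<^sub>R \<bar>r - t\<bar>)) \<longlongrightarrow> S t (A x)) (at t within {0..})"
  proof (rule tendsto_strong_apply)
    show "\<forall>\<^sub>F r in at t within {0..}. norm (S (min r t)) \<le> M"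
      using M t by (auto simp: eventually_at_filter)
    have "continuous_on {0..} (\<lambda>r. S (min r t) (A x))"
      using t by (intro continuous_on_compose2[OF S_cont[of "A x"]] continuous_intros) auto
    then show "((\<lambda>r. S (min r t) (A x)) \<longlongrightarrow> S t (A x)) (at t within {0..})"
      using t by (force simp: continuous_on)
    have "((\<lambda>r. \<bar>r - t\<bar>) \<longlongrightarrow> 0) (at t within {0..})"
      by (auto intro!: tendsto_eq_intros)
    then have "filterlim (\<lambda>r. \<bar>r - t\<bar>) (at_right 0) (at t within {0..})"
      unfolding filterlim_at by (auto simp: eventually_at_filter)
    from filterlim_compose[OF A[OF x] this]
    show "((\<lambda>r. (S \<bar>r - t\<bar> x - x) /\<^sub>R \<bar>r - t\<bar>) \<longlongrightarrow> A x) (at t within {0..})" .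
  qed
  also have "?this \<longleftrightarrow> ((\<lambda>r. (S r x - S t x) /\<^sub>R (r - t)) \<longlongrightarrow> S t (A x)) (at t within {0..})"
  proof (rule Lim_cong_within)
    fix r :: real assume r: "r \<in> {0..}"
    show "S (min r t) ((S \<bar>r - t\<bar> x - x) /\<^sub>R \<bar>r - t\<bar>) = (S r x - S t x) /\<^sub>R (r - t)"
    proof (cases "r \<le> t")
      case True
      have "S t x = S r (S (t - r) x)"
        using S_add[of r "t - r"] r True by simp
      moreover have "inverse (t - r) = - inverse (r - t)"
        by (metis inverse_minus_eq minus_diff_eq)
      ultimately show ?thesis
        using True by (simp add: blinfun.scaleR_right blinfun.diff_right algebra_simps)
    next
      case False
      have "S r x = S t (S (r - t) x)"
        using S_add[of t "r - t"] t False by simp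
      then show ?thesis
        using False by (simp add: min_def blinfun.scaleR_right blinfun.diff_right)
    qed
  qed auto
  finally show "((\<lambda>r. S r x) has_vector_derivative A (S t x)) (at t within {0..})"
    unfolding has_vector_derivative_iff_slope A_eq .
qed

section \<open>Lyapunov forms along a semigroup\<close>

text \<open>Nonnegativity of the form at \<open>c x - P x\<close> and its upper bound at \<open>x\<close> and \<open>P x\<close> combine to
  \<open>\<parallel>P x\<parallel>\<^sup>2 \<le> c\<^sup>2 \<parallel>x\<parallel>\<^sup>2\<close>.\<close>
lemma norm_le_of_form_bound:
  fixes P :: "'a::real_inner \<Rightarrow>\<^sub>L 'a"
  assumes sa: "self_adjoint P" and pos: "0 \<prec> P" and le: "P \<preceq> c *\<^sub>R id_blinfun" and c: "0 < c"
  shows "norm P \<le> c"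
proof (rule norm_blinfun_bound)
  fix x
  have form: "0 \<le> h \<bullet> P h" for h
    using pos unfolding op_less_def by (cases "h = 0") (auto intro: less_imp_le)
  have form_le: "h \<bullet> P h \<le> c * (norm h)\<^sup>2" for h
    using le[unfolded op_le_def, rule_format, of h]
    by (simp add: blinfun.diff_left blinfun.scaleR_left inner_diff_right power2_norm_eq_inner)
  have sa': "x \<bullet> P (P x) = P x \<bullet> P x"
    using sa unfolding self_adjoint_def by simp
  have "0 \<le> (c *\<^sub>R x - P x) \<bullet> P (c *\<^sub>R x - P x)" by (rule form)
  also have "\<dots> = c\<^sup>2 * (x \<bullet> P x) - 2 * c * (norm (P x))\<^sup>2 + P x \<bullet> P (P x)"
    unfolding power2_norm_eq_inner
    by (simp add: blinfun.diff_right blinfun.scaleR_right inner_diff_left inner_diff_right sa'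
        power2_eq_square inner_commute algebra_simps)
  also have "\<dots> \<le> c\<^sup>2 * (c * (norm x)\<^sup>2) - 2 * c * (norm (P x))\<^sup>2 + c * (norm (P x))\<^sup>2"
    using form_le c by (intro add_mono diff_mono mult_left_mono) auto
  finally have "c * (norm (P x))\<^sup>2 \<le> c * (c * norm x)\<^sup>2"
    by (simp add: power2_eq_square algebra_simps)
  then have "(norm (P x))\<^sup>2 \<le> (c * norm x)\<^sup>2" using c by simp
  then show "norm (P x) \<le> c * norm x" by (rule power2_le_imp_le) (use c in simp)
qed (use c in simp)

text \<open>Dissipation in a form without integrals: \<open>\<delta>\<close> is a lower bound for the norm along the orbit.  The
  function \<open>g\<close> in the proof is the value of the form plus \<open>\<alpha> \<delta>\<^sup>2\<close> times the elapsed time; its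
  derivative is at most \<open>\<alpha> (\<delta>\<^sup>2 - \<parallel>y r\<parallel>\<^sup>2) \<le> 0\<close>.\<close>
lemma lyapunov_decrease:
  fixes S :: "real \<Rightarrow> 'a::{real_inner, complete_space} \<Rightarrow>\<^sub>L 'a"
  assumes gen: "generates A D S" and ab: "a \<le> b"
    and deriv: "has_strong_derivative_on P P' {a..b}"
    and sa: "\<And>\<tau>. \<tau> \<in> {a..b} \<Longrightarrow> self_adjoint (P \<tau>)"
    and bounded: "\<And>\<tau>. \<tau> \<in> {a..b} \<Longrightarrow> norm (P \<tau>) \<le> c"
    and ineq: "\<And>\<tau> d. \<tau> \<in> {a<..<b} \<Longrightarrow> d \<in> D \<Longrightarrow>
        d \<bullet> P' \<tau> d + lyapunov_form A (P \<tau>) d \<le> - \<alpha> * (norm d)\<^sup>2"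
    and \<alpha>: "0 \<le> \<alpha>" and x: "x \<in> D"
    and \<delta>: "0 \<le> \<delta>" "\<And>r. r \<in> {0..b - a} \<Longrightarrow> \<delta> \<le> norm (S r x)"
  shows "S (b - a) x \<bullet> P b (S (b - a) x) + \<alpha> * \<delta>\<^sup>2 * (b - a) \<le> x \<bullet> P a x"
proof -
  define y where "y r = S (r - a) x" for r
  have y_D: "y r \<in> D" if "r \<in> {a..b}" for r
    using generator_orbit(1)[OF gen x] that by (simp add: y_def)
  have y: "(y has_vector_derivative A (y r)) (at r within {a..b})" if r: "r \<in> {a..b}" for r
  proof -
    have "((\<lambda>r. S r x) has_vector_derivative A (S (r - a) x)) (at (r - a) within (\<lambda>r. r - a) ` {a..b})"
      by (rule has_vector_derivative_within_subset[OF generator_orbit(2)[OF gen x]]) (use r in auto)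
    then have "((\<lambda>r. S r x) \<circ> (\<lambda>r. r - a) has_vector_derivative 1 *\<^sub>R A (S (r - a) x))
        (at r within {a..b})"
      by (rule vector_diff_chain_within[rotated]) (auto intro!: derivative_eq_intros)
    then show ?thesis by (simp add: o_def y_def[abs_def])
  qed
  define g where "g r = y r \<bullet> P r (y r) + \<alpha> * \<delta>\<^sup>2 * (r - a)" for r
  define g' where "g' r = y r \<bullet> (P' r (y r) + P r (A (y r))) + A (y r) \<bullet> P r (y r) + \<alpha> * \<delta>\<^sup>2" for r
  have P: "((\<lambda>\<sigma>. P \<sigma> h) has_vector_derivative P' r h) (at r within {a..b})" if "r \<in> {a..b}" for r h
    using deriv that unfolding has_strong_derivative_on_def by blast
  have g: "(g has_real_derivative g' r) (at r within {a..b})" if r: "r \<in> {a..b}" for r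
  proof -
    have "((\<lambda>\<sigma>. P \<sigma> (y \<sigma>)) has_vector_derivative P' r (y r) + P r (A (y r))) (at r within {a..b})"
    proof (rule has_vector_derivative_strong_apply[OF bounded P[OF r] y[OF r]])
      show "((\<lambda>\<sigma>. P \<sigma> (A (y r))) \<longlongrightarrow> P r (A (y r))) (at r within {a..b})"
        using has_vector_derivative_continuous[OF P[OF r]]
        by (simp add: continuous_within)
    qed
    from bounded_bilinear.has_vector_derivative[OF bounded_bilinear_inner y[OF r] this]
    have "((\<lambda>\<sigma>. y \<sigma> \<bullet> P \<sigma> (y \<sigma>)) has_real_derivative
        y r \<bullet> (P' r (y r) + P r (A (y r))) + A (y r) \<bullet> P r (y r)) (at r within {a..b})"
      by (simp add: has_real_derivative_iff_has_vector_derivative)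
    then show ?thesis unfolding g_def[abs_def] g'_def
      by (auto intro!: derivative_eq_intros)
  qed
  have g'_le: "g' r \<le> 0" if r: "a < r" "r < b" for r
  proof -
    have "y r \<bullet> P r (A (y r)) = P r (y r) \<bullet> A (y r)"
      using sa[of r] r by (simp add: self_adjoint_def)
    then have "g' r = y r \<bullet> P' r (y r) + lyapunov_form A (P r) (y r) + \<alpha> * \<delta>\<^sup>2"
      by (simp add: g'_def lyapunov_form_def inner_add_right)
    also have "\<dots> \<le> - \<alpha> * (norm (y r))\<^sup>2 + \<alpha> * \<delta>\<^sup>2"
      using ineq[of r "y r"] y_D[of r] r by simp
    also have "\<dots> = - \<alpha> * ((norm (y r))\<^sup>2 - \<delta>\<^sup>2)" by (simp add: algebra_simps)
    also have "\<dots> \<le> 0"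
      using \<alpha> \<delta>(1) \<delta>(2)[of "r - a"] r by (simp add: y_def power_mono)
    finally show ?thesis .
  qed
  have "g b \<le> g a"
  proof (rule DERIV_nonpos_imp_decreasing_open[OF ab])
    show "\<exists>d. (g has_real_derivative d) (at r) \<and> d \<le> 0" if "a < r" "r < b" for r
      using g[of r] g'_le[of r] that by (auto simp: at_within_Icc_at)
    show "continuous_on {a..b} g"
      using g DERIV_continuous continuous_on_eq_continuous_within by blast
  qed
  moreover have "S 0 x = x"
    using gen by (simp add: generates_def C0_semigroup_def)
  ultimately show ?thesis by (simp add: g_def y_def)
qed

section \<open>Uniform exponential decay from dissipation\<close>

lemma norm_blinfun_le_of_dense:
  fixes f :: "'a::real_normed_vector \<Rightarrow>\<^sub>L 'b::real_normed_vector"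
  assumes dense: "closure D = UNIV" and b: "0 \<le> b"
    and le: "\<And>x. x \<in> D \<Longrightarrow> norm (f x) \<le> b * norm x"
  shows "norm f \<le> b"
proof (rule norm_blinfun_bound[OF b])
  fix x
  have "closed {x. norm (f x) \<le> b * norm x}"
    by (intro closed_Collect_le continuous_intros)
  then have "closure D \<subseteq> {x. norm (f x) \<le> b * norm x}"
    using le by (intro closure_minimal) auto
  then show "norm (f x) \<le> b * norm x" using dense by auto
qed

text \<open>The constants of the decay estimate: \<open>gain\<close> bounds the squared norm of the evolution over any time
  span, and the norm is at most one half after \<open>halving_time\<close>.  They depend on the constants of the
  dissipation hypotheses and on nothing else of the evolution, which makes the estimate uniform
  over a family of evolutions.\<close>
definition gain :: "real \<Rightarrow> real \<Rightarrow> real \<Rightarrow> real \<Rightarrow> real" where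
  "gain c a K T = K\<^sup>2 * (1 + c / (a * T))"

definition halving_time :: "real \<Rightarrow> real \<Rightarrow> real \<Rightarrow> real \<Rightarrow> real" where
  "halving_time c a K T = 4 * gain c a K T * c / a"

lemma gain_ge:
  assumes const: "0 < c" "0 < a" "1 \<le> K" "0 < T"
  shows "K\<^sup>2 \<le> gain c a K T" "K\<^sup>2 * c / (a * T) \<le> gain c a K T" "1 \<le> gain c a K T"
proof -
  have gain: "gain c a K T = K\<^sup>2 + K\<^sup>2 * c / (a * T)" by (simp add: gain_def algebra_simps)
  have "0 \<le> K\<^sup>2 * c / (a * T)" using const by (intro divide_nonneg_pos mult_nonneg_nonneg) auto
  moreover have "1 \<le> K\<^sup>2" using const by (simp add: one_le_power)
  ultimately show "K\<^sup>2 \<le> gain c a K T" "K\<^sup>2 * c / (a * T) \<le> gain c a K T" "1 \<le> gain c a K T"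
    using gain by auto
qed

lemma halving_time_pos:
  assumes "0 < c" "0 < a" "1 \<le> K" "0 < T"
  shows "0 < halving_time c a K T"
  using assms gain_ge(3)[OF assms] by (simp add: halving_time_def)

text \<open>A two-parameter evolution with a functional \<open>V\<close> that dissipates along its orbits, but that need not
  dominate the norm.  \<open>D\<close> stands for initial values regular enough
  to differentiate \<open>V\<close> along their orbits.\<close>
locale dissipative_evolution =
  fixes \<Phi> :: "real \<Rightarrow> real \<Rightarrow> 'a::real_normed_vector \<Rightarrow>\<^sub>L 'a"
    and D :: "'a set"
    and V :: "real \<Rightarrow> 'a \<Rightarrow> real"
    and c a K T :: real
  assumes const: "0 < c" "0 < a" "1 \<le> K" "0 < T"
    and dense: "closure D = UNIV"
    and cocycle: "\<And>s r t. 0 \<le> s \<Longrightarrow> s \<le> r \<Longrightarrow> r \<le> t \<Longrightarrow> \<Phi> t s = \<Phi> t r o\<^sub>L \<Phi> r s"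
    and invariant: "\<And>s t x. 0 \<le> s \<Longrightarrow> s \<le> t \<Longrightarrow> x \<in> D \<Longrightarrow> \<Phi> t s x \<in> D"
    and window: "\<And>s t. 0 \<le> s \<Longrightarrow> s \<le> t \<Longrightarrow> t \<le> s + T \<Longrightarrow> norm (\<Phi> t s) \<le> K"
    and V_nonneg: "\<And>t x. 0 \<le> t \<Longrightarrow> 0 \<le> V t x"
    and V_le: "\<And>t x. 0 \<le> t \<Longrightarrow> V t x \<le> c * (norm x)\<^sup>2"
    and dissipation: "\<And>s t x \<delta>. 0 \<le> s \<Longrightarrow> s \<le> t \<Longrightarrow> x \<in> D \<Longrightarrow> 0 \<le> \<delta> \<Longrightarrow>
        (\<And>r. s \<le> r \<Longrightarrow> r \<le> t \<Longrightarrow> \<delta> \<le> norm (\<Phi> r s x)) \<Longrightarrow>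
        V t (\<Phi> t s x) + a * \<delta>\<^sup>2 * (t - s) \<le> V s x"
begin

abbreviation "B \<equiv> gain c a K T"

abbreviation "\<tau> \<equiv> halving_time c a K T"

lemmas B_ge = gain_ge[OF const]

lemmas \<tau>_pos = halving_time_pos[OF const]

text \<open>By the window bound, a large norm at time \<open>t\<close> forces a large norm on all of \<open>[t - T, t]\<close>, and the
  dissipation there cannot exceed the initial value of \<open>V\<close>.\<close>
lemma orbit_bounded:
  assumes st: "0 \<le> s" "s \<le> t" and x: "x \<in> D"
  shows "(norm (\<Phi> t s x))\<^sup>2 \<le> B * (norm x)\<^sup>2"
proof (cases "t \<le> s + T")
  case True
  have "norm (\<Phi> t s x) \<le> norm (\<Phi> t s) * norm x" by (rule norm_blinfun)
  also have "\<dots> \<le> K * norm x"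
    using window[OF st True] by (rule mult_right_mono) simp
  finally have "(norm (\<Phi> t s x))\<^sup>2 \<le> (K * norm x)\<^sup>2" by (rule power_mono) simp
  also have "\<dots> \<le> B * (norm x)\<^sup>2"
    unfolding power_mult_distrib using B_ge by (intro mult_right_mono) auto
  finally show ?thesis .
next
  case False
  define u where "u = t - T"
  have u: "s \<le> u" "u \<le> t" "0 \<le> u" using False st const by (auto simp: u_def)
  define y where "y = \<Phi> u s x"
  define \<delta> where "\<delta> = norm (\<Phi> t s x) / K"
  have \<delta>: "\<delta> \<le> norm (\<Phi> r u y)" if "u \<le> r" "r \<le> t" for r
  proof -
    have "\<Phi> t s x = \<Phi> t r (\<Phi> r u y)"
      using cocycle[of s u t] cocycle[of u r t] u st that by (simp add: y_def)
    then have "norm (\<Phi> t s x) \<le> norm (\<Phi> t r) * norm (\<Phi> r u y)"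
      by (simp add: norm_blinfun)
    also have "\<dots> \<le> K * norm (\<Phi> r u y)"
      using that u by (intro mult_right_mono window) (auto simp: u_def)
    finally show ?thesis using const by (simp add: \<delta>_def field_simps)
  qed
  have "V u y \<le> V s x"
    using dissipation[of s u x 0] u st x by (simp add: y_def)
  moreover have "V t (\<Phi> t u y) + a * \<delta>\<^sup>2 * (t - u) \<le> V u y"
    using u x st const by (intro dissipation \<delta>) (auto simp: y_def invariant \<delta>_def)
  moreover have "0 \<le> V t (\<Phi> t u y)" "V s x \<le> c * (norm x)\<^sup>2"
    using V_nonneg V_le st by auto
  ultimately have "a * \<delta>\<^sup>2 * T \<le> c * (norm x)\<^sup>2" by (simp add: u_def)
  then have "(norm (\<Phi> t s x))\<^sup>2 \<le> K\<^sup>2 * c / (a * T) * (norm x)\<^sup>2"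
    using const by (simp add: \<delta>_def power_divide field_simps)
  also have "\<dots> \<le> B * (norm x)\<^sup>2"
    using B_ge by (intro mult_right_mono) auto
  finally show ?thesis .
qed

text \<open>By \<open>orbit_bounded\<close> the norm at the final time bounds the norm at all earlier times from below, so
  the dissipation is proportional to the length \<open>\<tau>\<close> of the time span.\<close>
lemma orbit_halved:
  assumes s: "0 \<le> s" and x: "x \<in> D"
  shows "norm (\<Phi> (s + \<tau>) s x) \<le> norm x / 2"
proof -
  define t where "t = s + \<tau>"
  define \<delta> where "\<delta> = norm (\<Phi> t s x) / sqrt B"
  have \<delta>: "\<delta> \<le> norm (\<Phi> r s x)" if "s \<le> r" "r \<le> t" for r
  proof -
    have "(norm (\<Phi> t s x))\<^sup>2 \<le> B * (norm (\<Phi> r s x))\<^sup>2"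
      using orbit_bounded[of r t "\<Phi> r s x"] cocycle[of s r t] invariant[of s r x] s x that by simp
    then have "norm (\<Phi> t s x) \<le> sqrt B * norm (\<Phi> r s x)"
      by (metis norm_ge_zero real_le_rsqrt real_sqrt_mult real_sqrt_unique)
    then show ?thesis using B_ge by (simp add: \<delta>_def field_simps)
  qed
  have "V t (\<Phi> t s x) + a * \<delta>\<^sup>2 * (t - s) \<le> V s x"
    using s x \<tau>_pos B_ge by (intro dissipation \<delta>) (auto simp: t_def \<delta>_def)
  moreover have "0 \<le> V t (\<Phi> t s x)" "V s x \<le> c * (norm x)\<^sup>2"
    using V_nonneg V_le s \<tau>_pos by (auto simp: t_def)
  ultimately have "a * \<delta>\<^sup>2 * \<tau> \<le> c * (norm x)\<^sup>2" by (simp add: t_def)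
  moreover have "a * \<delta>\<^sup>2 * \<tau> = 4 * c * (norm (\<Phi> t s x))\<^sup>2"
    using const B_ge by (simp add: \<delta>_def halving_time_def power_divide)
  ultimately have "(norm (\<Phi> t s x))\<^sup>2 \<le> (norm x / 2)\<^sup>2"
    using const by (simp add: power_divide)
  then show ?thesis unfolding t_def by (rule power2_le_imp_le) simp
qed

text \<open>Each time span \<open>\<tau>\<close> contributes a factor one half; the factor 2 pays for the incomplete last one.\<close>
theorem exponential_decay:
  assumes st: "0 \<le> s" "s \<le> t"
  shows "norm (\<Phi> t s) \<le> 2 * sqrt B * exp (- (ln 2 / \<tau>) * (t - s))"
proof -
  have bounded: "norm (\<Phi> t s) \<le> sqrt B" if "0 \<le> s" "s \<le> t" for s t
  proof (rule norm_blinfun_le_of_dense[OF dense])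
    fix x assume "x \<in> D"
    from orbit_bounded[OF that this] show "norm (\<Phi> t s x) \<le> sqrt B * norm x"
      by (metis norm_ge_zero real_le_rsqrt real_sqrt_mult real_sqrt_unique)
  qed (use B_ge in simp)
  have half: "norm (\<Phi> (s + \<tau>) s) \<le> 1 / 2" if "0 \<le> s" for s
    by (rule norm_blinfun_le_of_dense[OF dense]) (use orbit_halved[OF that] in auto)
  have steps: "norm (\<Phi> (s + real n * \<tau> + r) s) \<le> sqrt B * (1 / 2) ^ n" if "0 \<le> s" "0 \<le> r" for s r n
    using \<open>0 \<le> s\<close>
  proof (induction n arbitrary: s)
    case 0
    then show ?case using bounded[of s "s + r"] that by simp
  next
    case (Suc n)
    have eq: "s + real (Suc n) * \<tau> + r = (s + \<tau>) + real n * \<tau> + r" by (simp add: algebra_simps)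
    have "0 \<le> real n * \<tau>" using \<tau>_pos by simp
    then have "\<Phi> ((s + \<tau>) + real n * \<tau> + r) s = \<Phi> ((s + \<tau>) + real n * \<tau> + r) (s + \<tau>) o\<^sub>L \<Phi> (s + \<tau>) s"
      using Suc.prems that \<tau>_pos by (intro cocycle) auto
    then have "norm (\<Phi> (s + real (Suc n) * \<tau> + r) s)
        \<le> norm (\<Phi> ((s + \<tau>) + real n * \<tau> + r) (s + \<tau>)) * norm (\<Phi> (s + \<tau>) s)"
      unfolding eq by (simp add: norm_blinfun_compose)
    also have "\<dots> \<le> (sqrt B * (1 / 2) ^ n) * (1 / 2)"
      using Suc \<tau>_pos half B_ge by (intro mult_mono) auto
    finally show ?case by simp
  qed
  define n where "n = nat \<lfloor>(t - s) / \<tau>\<rfloor>"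
  have "0 \<le> (t - s) / \<tau>" using st \<tau>_pos by simp
  then have n: "real n \<le> (t - s) / \<tau>" "(t - s) / \<tau> < real n + 1"
    by (auto simp: n_def)
  then have "real n * \<tau> \<le> t - s" using \<tau>_pos by (simp add: field_simps)
  then have "norm (\<Phi> t s) \<le> sqrt B * (1 / 2) ^ n"
    using steps[of s "t - s - real n * \<tau>" n] st by simp
  also have "(1 / 2 :: real) ^ n \<le> 2 * exp (- (ln 2 / \<tau>) * (t - s))"
  proof -
    have "(1 / 2 :: real) ^ n = exp (- ln 2 * real n)"
      unfolding exp_of_nat2_mult by (simp add: exp_minus inverse_eq_divide)
    also have "\<dots> \<le> exp (ln 2 + - ln 2 * ((t - s) / \<tau>))"
    proof -
      have "ln 2 * ((t - s) / \<tau>) \<le> ln 2 * (real n + 1)"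
        using n by (intro mult_left_mono) auto
      then show ?thesis unfolding exp_le_cancel_iff distrib_left by linarith
    qed
    also have "\<dots> = 2 * exp (- (ln 2 / \<tau>) * (t - s))"
      unfolding exp_add by simp
    finally show ?thesis .
  qed
  finally show ?thesis using B_ge by (simp add: mult.assoc mult.left_commute)
qed

end

section \<open>The evolution family of a switched system\<close>

text \<open>Induction over the instants up to \<open>r\<close>.  When none is left, \<open>r\<close> cuts the mode interval that starts
  at \<open>s\<close>, and the semigroup law of its mode splits the first piece of the flow there.\<close>
lemma flow_along_append:
  assumes "0 \<le> s" "s \<le> r" "r \<le> u"
    and "sorted rs" "distinct rs" "set rs = switching_instants \<eta> \<inter> {s<..r}"
    and qs: "\<And>q. q \<in> set qs \<Longrightarrow> r < q \<and> q \<le> u"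
    and semigroup: "\<And>p a b. 0 \<le> p \<Longrightarrow> 0 \<le> a \<Longrightarrow> 0 \<le> b \<Longrightarrow> S (\<eta> p) (a + b) = S (\<eta> p) a o\<^sub>L S (\<eta> p) b"
    and const_mode: "\<And>p. 0 \<le> p \<Longrightarrow> p \<le> r \<Longrightarrow> switching_instants \<eta> \<inter> {p<..r} = {} \<Longrightarrow> \<eta> r = \<eta> p"
  shows "flow_along S \<eta> s (rs @ qs) u = flow_along S \<eta> r qs u o\<^sub>L flow_along S \<eta> s rs r"
  using assms(1-6)
proof (induction rs arbitrary: s)
  case Nil
  then have mode: "\<eta> r = \<eta> s" using const_mode[of s] by simp
  have split: "S (\<eta> s) (q - s) = S (\<eta> r) (q - r) o\<^sub>L S (\<eta> s) (r - s)" if "r \<le> q" for q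
    using semigroup[of s "q - r" "r - s"] Nil that by (simp add: mode)
  show ?case
  proof (cases qs)
    case Nil
    then show ?thesis using split[of u] assms(3) by simp
  next
    case (Cons q qs')
    then show ?thesis using split[of q] qs[of q] by (auto intro!: blinfun_eqI)
  qed
next
  case (Cons p ps)
  have p: "p \<in> switching_instants \<eta>" "s < p" "p \<le> r"
    using Cons.prems(6) list.set_intros(1)[of p ps] by auto
  have "set ps = switching_instants \<eta> \<inter> {p<..r}"
  proof -
    have "\<forall>q\<in>set ps. p < q" using Cons.prems by (auto simp: order_less_le)
    moreover have "insert p (set ps) = switching_instants \<eta> \<inter> {s<..r}" using Cons.prems by simp
    ultimately show ?thesis using p by fastforce
  qed
  then have "flow_along S \<eta> p (ps @ qs) u = flow_along S \<eta> r qs u o\<^sub>L flow_along S \<eta> p ps r"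
    using Cons.prems p by (intro Cons.IH) auto
  then show ?case by (auto intro!: blinfun_eqI)
qed

locale switched_semigroups =
  fixes S :: "nat \<Rightarrow> real \<Rightarrow> 'a::real_normed_vector \<Rightarrow>\<^sub>L 'a"
    and N :: nat and \<eta> :: "real \<Rightarrow> nat" and t :: "nat \<Rightarrow> real"
  assumes semigroup: "\<And>i. i \<in> {1..N} \<Longrightarrow> C0_semigroup (S i)"
    and switching: "switching_sequence N \<eta> t"
begin

lemma t_0: "t 0 = 0"
  and instants: "switching_instants \<eta> = t ` {1..}"
  and mode_in: "\<eta> (t k) \<in> {1..N}"
  and mode_eq: "t k \<le> r \<Longrightarrow> r < t (Suc k) \<Longrightarrow> \<eta> r = \<eta> (t k)"
  and mode_change: "\<eta> (t (Suc k)) \<noteq> \<eta> (t k)"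
  using switching unfolding switching_sequence_def by auto

lemma strict_mono_t: "strict_mono t"
  using switching unfolding switching_sequence_def by (simp add: strict_mono_Suc_iff)

lemma t_nonneg: "0 \<le> t k"
  using strict_mono_mono[OF strict_mono_t, THEN monoD, of 0 k] t_0 by simp

lemma exceeds: "\<exists>k. r < t k"
proof -
  have "filterlim t at_top sequentially"
    using switching unfolding switching_sequence_def by blast
  then have "\<forall>\<^sub>F k in sequentially. r < t k" by (simp add: filterlim_at_top_dense)
  then show ?thesis by (auto simp: eventually_sequentially)
qed

lemma interval_exists:
  assumes "0 \<le> r"
  obtains k where "t k \<le> r" "r < t (Suc k)"
proof -
  define n where "n = (LEAST n. r < t n)"
  have n: "r < t n" unfolding n_def using exceeds by (rule LeastI_ex)
  then obtain k where k: "n = Suc k" using assms t_0 by (cases n) auto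
  have "\<not> r < t k" using not_less_Least[of k "\<lambda>n. r < t n"] k n_def by simp
  then show ?thesis using that[of k] n k by simp
qed

lemma interval_unique:
  assumes "t k \<le> r" "r < t (Suc k)" "t l \<le> r" "r < t (Suc l)"
  shows "k = l"
proof -
  have "t k < t (Suc l)" "t l < t (Suc k)" using assms by linarith+
  then show ?thesis using strict_mono_less[OF strict_mono_t] by (simp add: less_Suc_eq_le)
qed

lemma mode_range: "0 \<le> r \<Longrightarrow> \<eta> r \<in> {1..N}"
  using interval_exists[of r] mode_eq mode_in by metis

lemma no_instants_inside:
  assumes "t k \<le> s" "r < t (Suc k)"
  shows "switching_instants \<eta> \<inter> {s<..r} = {}"
proof -
  have False if "s < t l" "t l \<le> r" for l
  proof -
    have "t k < t l" "t l < t (Suc k)" using assms that by linarith+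
    then show False using strict_mono_less[OF strict_mono_t] by simp
  qed
  then show ?thesis by (auto simp: instants)
qed

lemma mode_constant:
  assumes "0 \<le> s" "s \<le> r" "switching_instants \<eta> \<inter> {s<..r} = {}"
  shows "\<eta> r = \<eta> s"
proof -
  obtain k where k: "t k \<le> s" "s < t (Suc k)" using interval_exists assms by blast
  have "t (Suc k) \<in> switching_instants \<eta>" by (simp add: instants)
  then have "r < t (Suc k)" using assms k by force
  then show ?thesis using mode_eq[of k r] mode_eq[of k s] k assms by simp
qed

lemma finite_instants: "finite (switching_instants \<eta> \<inter> {s<..r})"
proof -
  obtain n where n: "r < t n" using exceeds by blast
  have "switching_instants \<eta> \<inter> {s<..r} \<subseteq> t ` {..n}"
  proof
    fix q assume "q \<in> switching_instants \<eta> \<inter> {s<..r}"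
    then obtain l where l: "q = t l" "t l \<le> r" by (auto simp: instants)
    then have "t l < t n" using n by simp
    then have "l \<le> n" using strict_mono_less[OF strict_mono_t] by simp
    then show "q \<in> t ` {..n}" using l by auto
  qed
  then show ?thesis by (rule finite_subset) simp
qed

lemma semigroup_add:
  "0 \<le> p \<Longrightarrow> 0 \<le> a \<Longrightarrow> 0 \<le> b \<Longrightarrow> S (\<eta> p) (a + b) = S (\<eta> p) a o\<^sub>L S (\<eta> p) b"
  using semigroup[OF mode_range] by (simp add: C0_semigroup_def)

lemma semigroup_0: "i \<in> {1..N} \<Longrightarrow> S i 0 = id_blinfun"
  using semigroup by (simp add: C0_semigroup_def)

lemma evolution_cocycle:
  assumes "0 \<le> s" "s \<le> r" "r \<le> u"
  shows "evolution S \<eta> u s = evolution S \<eta> u r o\<^sub>L evolution S \<eta> r s"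
proof -
  let ?X = "switching_instants \<eta> \<inter> {s<..r}" and ?Y = "switching_instants \<eta> \<inter> {r<..u}"
  have fin: "finite ?X" "finite ?Y" by (rule finite_instants)+
  have "switching_instants \<eta> \<inter> {s<..u} = ?X \<union> ?Y" using assms by auto
  moreover have "sorted_list_of_set (?X \<union> ?Y) = sorted_list_of_set ?X @ sorted_list_of_set ?Y"
    using fin by (intro sorted_distinct_set_unique) (auto simp: sorted_append)
  moreover have "flow_along S \<eta> s (sorted_list_of_set ?X @ sorted_list_of_set ?Y) u
      = flow_along S \<eta> r (sorted_list_of_set ?Y) u o\<^sub>L flow_along S \<eta> s (sorted_list_of_set ?X) r"
  proof (rule flow_along_append[OF assms])
    show "set (sorted_list_of_set ?X) = ?X" using fin by simp
    show "r < q \<and> q \<le> u" if "q \<in> set (sorted_list_of_set ?Y)" for q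
      using that fin by simp
    show "\<eta> r = \<eta> p" if "0 \<le> p" "p \<le> r" "switching_instants \<eta> \<inter> {p<..r} = {}" for p
      using that by (rule mode_constant)
  qed (simp_all add: semigroup_add)
  ultimately show ?thesis unfolding evolution_def by simp
qed

text \<open>The interval is closed on the right: at \<open>r = t (Suc k)\<close> the next mode has acted for time 0 only.\<close>
lemma evolution_on_interval:
  assumes "t k \<le> s" "s \<le> r" "r \<le> t (Suc k)"
  shows "evolution S \<eta> r s = S (\<eta> (t k)) (r - s)"
proof -
  have s: "0 \<le> s" using t_nonneg[of k] assms by linarith
  consider "r < t (Suc k)" | "s < r" "r = t (Suc k)" | "s = r" using assms by linarith
  then show ?thesis
  proof cases
    case 1
    then show ?thesis
      unfolding evolution_def
      using no_instants_inside[of k s r] mode_eq[of k s] assms by simp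
  next
    case 2
    have "switching_instants \<eta> \<inter> {s<..r} = {r}"
    proof
      show "switching_instants \<eta> \<inter> {s<..r} \<subseteq> {r}"
      proof
        fix q assume q: "q \<in> switching_instants \<eta> \<inter> {s<..r}"
        show "q \<in> {r}"
          using no_instants_inside[of k s q] q assms 2 by fastforce
      qed
    qed (use 2 in \<open>auto simp: instants\<close>)
    then show ?thesis
      unfolding evolution_def
      using mode_eq[of k s] assms 2 semigroup_0[OF mode_in[of "Suc k"]]
      by (auto intro!: blinfun_eqI)
  next
    case 3
    then show ?thesis
      unfolding evolution_def using semigroup_0 mode_range[OF s] mode_in[of k] by simp
  qed
qed

text \<open>To establish a relation between the endpoints of time spans that can be concatenated, it suffices
  to treat spans within a single closed mode interval.\<close>
lemma interval_induct:
  assumes sr: "0 \<le> s" "s \<le> r"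
    and base: "\<And>k s r. t k \<le> s \<Longrightarrow> s \<le> r \<Longrightarrow> r \<le> t (Suc k) \<Longrightarrow> Q s r"
    and trans: "\<And>s q r. 0 \<le> s \<Longrightarrow> s \<le> q \<Longrightarrow> q \<le> r \<Longrightarrow> Q s q \<Longrightarrow> Q q r \<Longrightarrow> Q s r"
  shows "Q s r"
proof -
  have "Q s r" if "s \<le> r" "r \<le> t n" for n r
    using that
  proof (induction n arbitrary: r)
    case 0
    then show ?case using base[of 0 s r] t_0 sr(1) t_nonneg[of "Suc 0"] by simp
  next
    case (Suc n)
    show ?case
    proof (cases "t n \<le> s")
      case True
      then show ?thesis using base Suc.prems by blast
    next
      case False
      show ?thesis
      proof (cases "r \<le> t n")
        case True
        then show ?thesis using Suc by blast
      next
        case r: False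
        have "Q s (t n)" using Suc.IH[of "t n"] False by simp
        moreover have "Q (t n) r" using base[of n "t n" r] Suc.prems r by simp
        ultimately show ?thesis using trans[of s "t n" r] sr(1) False r by simp
      qed
    qed
  qed
  then show ?thesis using exceeds[of r] sr(2) less_imp_le by blast
qed

text \<open>The time since the last switch.  The initial mode, which may be left before time \<open>T\<close>, starts with
  its clock at \<open>T\<close>, so that the clock has reached \<open>T\<close> at every switch of a signal with dwell time \<open>T\<close>.\<close>
definition clock :: "real \<Rightarrow> real \<Rightarrow> real" where
  "clock T r = (let k = THE k. t k \<le> r \<and> r < t (Suc k) in if k = 0 then r + T else r - t k)"

lemma clock_eq:
  assumes "t k \<le> r" "r < t (Suc k)"
  shows "clock T r = (if k = 0 then r + T else r - t k)"
proof -
  have "(THE k. t k \<le> r \<and> r < t (Suc k)) = k"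
    using assms interval_unique by blast
  then show ?thesis by (simp add: clock_def)
qed

lemma clock_nonneg:
  assumes "0 \<le> r" "0 \<le> T"
  shows "0 \<le> clock T r"
proof -
  obtain k where "t k \<le> r" "r < t (Suc k)" using interval_exists assms(1) by blast
  then show ?thesis using clock_eq[of k r T] assms by simp
qed

end

section \<open>Decay of the switched system\<close>

text \<open>One mode with its clock running from \<open>u\<close> to \<open>v\<close>.  At clock time \<open>T\<close> the form stops changing, and
  the stationary inequality replaces the differential one.\<close>
lemma clocked_decrease:
  fixes S :: "real \<Rightarrow> 'a::{real_inner, complete_space} \<Rightarrow>\<^sub>L 'a"
  assumes gen: "generates A D S" and T: "0 < T"
    and deriv: "has_strong_derivative_on P P' {0..T}"
    and sa: "\<And>\<tau>. \<tau> \<in> {0..T} \<Longrightarrow> self_adjoint (P \<tau>)"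
    and bounded: "\<And>\<tau>. \<tau> \<in> {0..T} \<Longrightarrow> norm (P \<tau>) \<le> c"
    and flow: "\<And>\<tau> d. \<tau> \<in> {0<..<T} \<Longrightarrow> d \<in> D \<Longrightarrow>
        d \<bullet> P' \<tau> d + lyapunov_form A (P \<tau>) d \<le> - \<alpha> * (norm d)\<^sup>2"
    and hold: "\<And>d. d \<in> D \<Longrightarrow> lyapunov_form A (P T) d \<le> - \<alpha> * (norm d)\<^sup>2"
    and \<alpha>: "0 \<le> \<alpha>" and x: "x \<in> D" and uv: "0 \<le> u" "u \<le> v"
    and \<delta>: "0 \<le> \<delta>" "\<And>r. r \<in> {0..v - u} \<Longrightarrow> \<delta> \<le> norm (S r x)"
  shows "S (v - u) x \<bullet> P (min v T) (S (v - u) x) + \<alpha> * \<delta>\<^sup>2 * (v - u) \<le> x \<bullet> P (min u T) x"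
proof -
  have holding: "S h y \<bullet> P T (S h y) + \<alpha> * \<delta>\<^sup>2 * h \<le> y \<bullet> P T y"
    if "y \<in> D" "0 \<le> h" "\<And>r. r \<in> {0..h} \<Longrightarrow> \<delta> \<le> norm (S r y)" for y h
    using lyapunov_decrease[OF gen \<open>0 \<le> h\<close>, of "\<lambda>_. P T" "\<lambda>_ _. 0" c \<alpha> y \<delta>]
      that sa[of T] bounded[of T] hold T \<alpha> \<delta>(1)
    by (simp add: has_strong_derivative_on_def)
  have flowing: "S (w - u) x \<bullet> P w (S (w - u) x) + \<alpha> * \<delta>\<^sup>2 * (w - u) \<le> x \<bullet> P u x"
    if "u \<le> w" "w \<le> T" "w \<le> v" for w
  proof (rule lyapunov_decrease[OF gen \<open>u \<le> w\<close>, where c = c])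
    show "has_strong_derivative_on P P' {u..w}"
      using deriv uv that unfolding has_strong_derivative_on_def
      by (auto intro: has_vector_derivative_within_subset[of _ _ _ "{0..T}"])
  qed (use sa bounded flow \<alpha> x \<delta> uv that in auto)
  consider "v \<le> T" | "T \<le> u" | "u < T" "T < v" by linarith
  then show ?thesis
  proof cases
    case 1
    then show ?thesis using flowing[of v] uv by simp
  next
    case 2
    then show ?thesis using holding[of x "v - u"] x uv \<delta>(2) by simp
  next
    case 3
    define y where "y = S (T - u) x"
    have add: "S (r + (T - u)) x = S r y" if "0 \<le> r" for r
      using gen that 3 by (simp add: generates_def C0_semigroup_def y_def)
    have y: "y \<in> D" unfolding y_def using generator_orbit(1)[OF gen x] 3 by simp
    have "S (v - T) y \<bullet> P T (S (v - T) y) + \<alpha> * \<delta>\<^sup>2 * (v - T) \<le> y \<bullet> P T y"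
    proof (rule holding[OF y])
      show "\<delta> \<le> norm (S r y)" if "r \<in> {0..v - T}" for r
        using \<delta>(2)[of "r + (T - u)"] add[of r] that 3 by simp
    qed (use 3 in simp)
    moreover have "y \<bullet> P T y + \<alpha> * \<delta>\<^sup>2 * (T - u) \<le> x \<bullet> P u x"
      using flowing[of T] 3 by (simp add: y_def)
    moreover have "S (v - T) y = S (v - u) x" using add[of "v - T"] 3 by simp
    moreover have "\<alpha> * \<delta>\<^sup>2 * (v - u) = \<alpha> * \<delta>\<^sup>2 * (v - T) + \<alpha> * \<delta>\<^sup>2 * (T - u)"
      by (simp add: algebra_simps)
    ultimately show ?thesis using 3 by simp
  qed
qed

theorem theorem7p5:
  fixes A :: "nat \<Rightarrow> 'h::{real_inner, complete_space} \<Rightarrow> 'h"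
    and D :: "'h set"
    and S :: "nat \<Rightarrow> real \<Rightarrow> 'h \<Rightarrow>\<^sub>L 'h"
    and P :: "nat \<Rightarrow> real \<Rightarrow> 'h \<Rightarrow>\<^sub>L 'h"
    and P' :: "nat \<Rightarrow> real \<Rightarrow> 'h \<Rightarrow> 'h"
    and Q :: "nat \<Rightarrow> real \<Rightarrow> 'h \<Rightarrow>\<^sub>L 'h"
    and Q_inf :: "nat \<Rightarrow> 'h \<Rightarrow>\<^sub>L 'h"
    and N :: nat
    and T c_P \<alpha>_q \<alpha>_q_inf :: real
  assumes gen: "\<And>i. i \<in> {1..N} \<Longrightarrow> generates (A i) D (S i)"
    and T_pos: "0 < T"
    and const_pos: "0 < c_P" "0 < \<alpha>_q" "0 < \<alpha>_q_inf"
    and P_self_adjoint: "\<And>i \<tau>. i \<in> {1..N} \<Longrightarrow> \<tau> \<in> {0..T} \<Longrightarrow> self_adjoint (P i \<tau>)"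
    and P_deriv: "\<And>i. i \<in> {1..N} \<Longrightarrow> has_strong_derivative_on (P i) (P' i) {0..T}"
    and P_bounds: "\<And>i \<tau>. i \<in> {1..N} \<Longrightarrow> \<tau> \<in> {0..T} \<Longrightarrow>
                     0 \<prec> P i \<tau> \<and> P i \<tau> \<preceq> c_P *\<^sub>R id_blinfun"
    and Q_self_adjoint: "\<And>i \<tau>. i \<in> {1..N} \<Longrightarrow> \<tau> \<in> {0..T} \<Longrightarrow> self_adjoint (Q i \<tau>)"
    and Q_bound: "\<And>i \<tau>. i \<in> {1..N} \<Longrightarrow> \<tau> \<in> {0..T} \<Longrightarrow> \<alpha>_q *\<^sub>R id_blinfun \<preceq> Q i \<tau>"
    and Q_inf_self_adjoint: "\<And>i. i \<in> {1..N} \<Longrightarrow> self_adjoint (Q_inf i)"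
    and Q_inf_bound: "\<And>i. i \<in> {1..N} \<Longrightarrow> \<alpha>_q_inf *\<^sub>R id_blinfun \<preceq> Q_inf i"
    and flow_ineq: "\<And>i \<tau> d. i \<in> {1..N} \<Longrightarrow> \<tau> \<in> {0<..<T} \<Longrightarrow> d \<in> D \<Longrightarrow>
                      d \<bullet> P' i \<tau> d + lyapunov_form (A i) (P i \<tau>) d + d \<bullet> Q i \<tau> d \<le> 0"
    and hold_ineq: "\<And>i d. i \<in> {1..N} \<Longrightarrow> d \<in> D \<Longrightarrow>
                      lyapunov_form (A i) (P i T) d + d \<bullet> Q_inf i d \<le> 0"
    and jump_ineq: "\<And>i j. i \<in> {1..N} \<Longrightarrow> j \<in> {1..N} \<Longrightarrow> j \<noteq> i \<Longrightarrow> P j 0 \<preceq> P i T"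
  shows "UGES S (Sigma_min N T)"
proof -
  define a where "a = min \<alpha>_q \<alpha>_q_inf"
  have a: "0 < a" using const_pos by (simp add: a_def)
  have form_ge: "a * (norm d)\<^sup>2 \<le> d \<bullet> R d" if "\<beta> *\<^sub>R id_blinfun \<preceq> R" "a \<le> \<beta>" for \<beta> d and R :: "'h \<Rightarrow>\<^sub>L 'h"
  proof -
    have "\<beta> * (norm d)\<^sup>2 \<le> d \<bullet> R d"
      using that(1)[unfolded op_le_def, rule_format, of d]
      by (simp add: blinfun.diff_left blinfun.scaleR_left inner_diff_right power2_norm_eq_inner)
    then show ?thesis using mult_right_mono[OF that(2), of "(norm d)\<^sup>2"] by simp
  qed
  have flow: "d \<bullet> P' i \<tau> d + lyapunov_form (A i) (P i \<tau>) d \<le> - a * (norm d)\<^sup>2"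
    if "i \<in> {1..N}" "\<tau> \<in> {0<..<T}" "d \<in> D" for i \<tau> d
    using flow_ineq[OF that] form_ge[OF Q_bound[of i \<tau>], of d] that by (simp add: a_def)
  have hold: "lyapunov_form (A i) (P i T) d \<le> - a * (norm d)\<^sup>2"
    if "i \<in> {1..N}" "d \<in> D" for i d
    using hold_ineq[OF that] form_ge[OF Q_inf_bound[of i], of d] that by (simp add: a_def)
  have norm_P: "norm (P i \<tau>) \<le> c_P" if "i \<in> {1..N}" "\<tau> \<in> {0..T}" for i \<tau>
    using norm_le_of_form_bound[OF P_self_adjoint[OF that]] P_bounds[OF that] const_pos(1) by blast
  have form_nonneg: "0 \<le> x \<bullet> P i \<tau> x" if "i \<in> {1..N}" "\<tau> \<in> {0..T}" for i \<tau> x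
    using P_bounds[OF that] unfolding op_less_def
    by (cases "x = 0") (auto intro: less_imp_le)
  have form_le: "x \<bullet> P i \<tau> x \<le> c_P * (norm x)\<^sup>2" if "i \<in> {1..N}" "\<tau> \<in> {0..T}" for i \<tau> x
    using P_bounds[OF that] unfolding op_le_def
    by (simp add: blinfun.diff_left blinfun.scaleR_left inner_diff_right power2_norm_eq_inner)
  have C0: "C0_semigroup (S i)" if "i \<in> {1..N}" for i
    using gen[OF that] by (simp add: generates_def)
  have "\<forall>i\<in>{1..N}. \<exists>m. \<forall>r\<in>{0..T}. norm (S i r) \<le> m"
    using C0_semigroup_bounded[OF C0] by blast
  from bchoice[OF this] obtain m
    where m: "\<And>i r. i \<in> {1..N} \<Longrightarrow> r \<in> {0..T} \<Longrightarrow> norm (S i r) \<le> m i"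
    by blast
  define M where "M = 1 + (\<Sum>i\<in>{1..N}. \<bar>m i\<bar>)"
  have M: "1 \<le> M" unfolding M_def by (simp add: sum_nonneg)
  have norm_S: "norm (S i r) \<le> M" if "i \<in> {1..N}" "r \<in> {0..T}" for i r
  proof -
    have "\<bar>m i\<bar> \<le> (\<Sum>i\<in>{1..N}. \<bar>m i\<bar>)" using that by (intro member_le_sum) auto
    then show ?thesis using m[OF that] by (simp add: M_def)
  qed
  have K: "1 \<le> M\<^sup>2" using M by (simp add: one_le_power)
  define \<omega> where "\<omega> = ln 2 / halving_time c_P a (M\<^sup>2) T"
  have \<omega>: "0 < \<omega>"
    using halving_time_pos[OF const_pos(1) a K T_pos] by (simp add: \<omega>_def)
  have gain: "1 \<le> gain c_P a (M\<^sup>2) T" using gain_ge(3)[OF const_pos(1) a K T_pos] .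
  have decay: "norm (evolution S \<eta> r s) \<le> 2 * sqrt (gain c_P a (M\<^sup>2) T) * exp (- \<omega> * (r - s))"
    if \<eta>: "\<eta> \<in> Sigma_min N T" and sr: "0 \<le> s" "s \<le> r" for \<eta> s r
  proof -
    obtain t where t: "switching_sequence N \<eta> t" and dwell: "\<And>k. 1 \<le> k \<Longrightarrow> T \<le> t (Suc k) - t k"
      using \<eta> unfolding Sigma_min_def by blast
    interpret switched_semigroups S N \<eta> t
      by unfold_locales (use C0 t in auto)
    define V where "V r x = x \<bullet> P (\<eta> r) (min (clock T r) T) x" for r x
    have clock_range: "min (clock T r) T \<in> {0..T}" if "0 \<le> r" for r
      using clock_nonneg[OF that] T_pos by simp
    have V_on: "V r x = x \<bullet> P (\<eta> (t k)) (min (if k = 0 then r + T else r - t k) T) x"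
      if "t k \<le> r" "r < t (Suc k)" for k r x
      using mode_eq[OF that] clock_eq[OF that] by (simp add: V_def)
    \<comment> \<open>Invariance of \<open>D\<close> is carried along so that the estimates of successive spans can be concatenated.\<close>
    define decreasing where "decreasing s r \<longleftrightarrow> (\<forall>x\<in>D. evolution S \<eta> r s x \<in> D \<and>
        (\<forall>\<delta>\<ge>0. (\<forall>q\<in>{s..r}. \<delta> \<le> norm (evolution S \<eta> q s x)) \<longrightarrow>
          V r (evolution S \<eta> r s x) + a * \<delta>\<^sup>2 * (r - s) \<le> V s x))" for s r
    have decreasing: "decreasing s r" if "0 \<le> s" "s \<le> r" for s r
      using that
    proof (rule interval_induct)
      fix k s r assume ksr: "t k \<le> s" "s \<le> r" "r \<le> t (Suc k)"
      \<comment> \<open>On the \<open>k\<close>-th mode interval the clock shows \<open>r + ?o\<close> at time \<open>r\<close>; at its right end the clock of the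
        outgoing mode still makes sense, while \<open>V\<close> already uses the incoming mode.\<close>
      let ?i = "\<eta> (t k)" and ?o = "if k = 0 then T else - t k"
      have i: "?i \<in> {1..N}" by (rule mode_in)
      have s: "0 \<le> s" using ksr t_nonneg[of k] by linarith
      have ev: "evolution S \<eta> q s = S ?i (q - s)" if "s \<le> q" "q \<le> r" for q
        using evolution_on_interval[of k s q] ksr that by simp
      show "decreasing s r"
        unfolding decreasing_def
      proof (intro ballI conjI allI impI)
        fix x assume x: "x \<in> D"
        let ?z = "S ?i (r - s) x"
        show "evolution S \<eta> r s x \<in> D"
          using generator_orbit(1)[OF gen[OF i] x] ev[of r] ksr by simp
        fix \<delta> :: real
        assume \<delta>: "0 \<le> \<delta>" "\<forall>q\<in>{s..r}. \<delta> \<le> norm (evolution S \<eta> q s x)"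
        show "V r (evolution S \<eta> r s x) + a * \<delta>\<^sup>2 * (r - s) \<le> V s x"
        proof (cases "s = r")
          case True
          then show ?thesis using ev[of r] semigroup_0[OF i] by simp
        next
          case False
          have "S ?i ((r + ?o) - (s + ?o)) x \<bullet> P ?i (min (r + ?o) T) (S ?i ((r + ?o) - (s + ?o)) x)
              + a * \<delta>\<^sup>2 * ((r + ?o) - (s + ?o)) \<le> x \<bullet> P ?i (min (s + ?o) T) x"
          proof (rule clocked_decrease[OF gen[OF i] T_pos P_deriv[OF i] P_self_adjoint[OF i]
                norm_P[OF i] flow[OF i] hold[OF i] less_imp_le[OF a] x])
            show "0 \<le> s + ?o" using s ksr T_pos by simp
            show "\<delta> \<le> norm (S ?i q x)" if "q \<in> {0..(r + ?o) - (s + ?o)}" for q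
              using \<delta>(2)[rule_format, of "s + q"] ev[of "s + q"] that by simp
          qed (use ksr \<delta> in simp_all)
          then have *: "?z \<bullet> P ?i (min (r + ?o) T) ?z + a * \<delta>\<^sup>2 * (r - s) \<le> V s x"
            using V_on[of k s x] ksr False by (cases "k = 0") simp_all
          have "V r ?z \<le> ?z \<bullet> P ?i (min (r + ?o) T) ?z"
          proof (cases "r < t (Suc k)")
            case True
            then show ?thesis using V_on[of k r ?z] ksr by (cases "k = 0") simp_all
          next
            case at_switch: False
            then have r: "r = t (Suc k)" using ksr by simp
            have "P (\<eta> r) 0 \<preceq> P ?i T"
              using jump_ineq[OF i mode_in[of "Suc k"]] mode_change[of k] r by simp
            then have "?z \<bullet> P (\<eta> r) 0 ?z \<le> ?z \<bullet> P ?i T ?z"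
              unfolding op_le_def by (simp add: blinfun.diff_left inner_diff_right)
            moreover have "V r ?z = ?z \<bullet> P (\<eta> r) 0 ?z"
              using V_on[of "Suc k" r ?z] strict_mono_less[OF strict_mono_t, of "Suc k" "Suc (Suc k)"]
                r T_pos by simp
            moreover have "min (r + ?o) T = T"
              using dwell[of k] t_nonneg[of "Suc k"] r by (cases "k = 0") auto
            ultimately show ?thesis by simp
          qed
          then show ?thesis using * ev[of r] ksr by simp
        qed
      qed
    next
      fix s q r assume sqr: "0 \<le> s" "s \<le> q" "q \<le> r" and Q1: "decreasing s q" and Q2: "decreasing q r"
      have ev: "evolution S \<eta> p s x = evolution S \<eta> p q (evolution S \<eta> q s x)" if "q \<le> p" for p x
        using evolution_cocycle[OF sqr(1,2) that] by simp
      show "decreasing s r"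
        unfolding decreasing_def
      proof (intro ballI conjI allI impI)
        fix x assume x: "x \<in> D"
        let ?y = "evolution S \<eta> q s x"
        have y: "?y \<in> D" using Q1 x by (simp add: decreasing_def)
        then show "evolution S \<eta> r s x \<in> D" using Q2 ev[OF sqr(3)] by (simp add: decreasing_def)
        fix \<delta> :: real
        assume \<delta>: "0 \<le> \<delta>" "\<forall>p\<in>{s..r}. \<delta> \<le> norm (evolution S \<eta> p s x)"
        have "\<forall>p\<in>{q..r}. \<delta> \<le> norm (evolution S \<eta> p q ?y)"
        proof
          fix p assume p: "p \<in> {q..r}"
          then have "p \<in> {s..r}" using sqr by simp
          with \<delta>(2) have "\<delta> \<le> norm (evolution S \<eta> p s x)" ..
          then show "\<delta> \<le> norm (evolution S \<eta> p q ?y)"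
            using ev[of p x] p by simp
        qed
        then have "V r (evolution S \<eta> r q ?y) + a * \<delta>\<^sup>2 * (r - q) \<le> V q ?y"
          using Q2 y \<delta>(1) unfolding decreasing_def by blast
        moreover have "V q ?y + a * \<delta>\<^sup>2 * (q - s) \<le> V s x"
          using Q1 x \<delta> sqr unfolding decreasing_def by simp
        ultimately show "V r (evolution S \<eta> r s x) + a * \<delta>\<^sup>2 * (r - s) \<le> V s x"
          using ev[OF sqr(3), of x] by (simp add: algebra_simps)
      qed
    qed
    interpret dissipative_evolution "evolution S \<eta>" D V c_P a "M\<^sup>2" T
    proof unfold_locales
      show "0 < c_P" "0 < a" "1 \<le> M\<^sup>2" "0 < T" by fact+
      show "evolution S \<eta> r s = evolution S \<eta> r q o\<^sub>L evolution S \<eta> q s"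
        if "0 \<le> s" "s \<le> q" "q \<le> r" for s q r using that by (rule evolution_cocycle)
      show "closure D = UNIV"
        using generator_domain_dense[OF gen[OF mode_in[of 0]]] .
      show "evolution S \<eta> r s x \<in> D" if "0 \<le> s" "s \<le> r" "x \<in> D" for s r x
        using decreasing[OF that(1,2)] that(3) by (simp add: decreasing_def)
      show "0 \<le> V r x" "V r x \<le> c_P * (norm x)\<^sup>2" if "0 \<le> r" for r x
        unfolding V_def by (rule form_nonneg form_le; use mode_range clock_range that in blast)+
      show "V r (evolution S \<eta> r s x) + a * \<delta>\<^sup>2 * (r - s) \<le> V s x"
        if "0 \<le> s" "s \<le> r" "x \<in> D" "0 \<le> \<delta>"
          "\<And>q. s \<le> q \<Longrightarrow> q \<le> r \<Longrightarrow> \<delta> \<le> norm (evolution S \<eta> q s x)" for s r x \<delta>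
        using decreasing[OF that(1,2)] that(3-5) by (simp add: decreasing_def)
      show "norm (evolution S \<eta> r s) \<le> M\<^sup>2" if sr: "0 \<le> s" "s \<le> r" "r \<le> s + T" for s r
      proof -
        obtain k where k: "t k \<le> s" "s < t (Suc k)" using interval_exists sr(1) by blast
        show ?thesis
        \<comment> \<open>Two switches cannot both fall into \<open>{s<..s + T}\<close>, since they are at least \<open>T\<close> apart.\<close>
        proof (cases "r \<le> t (Suc k)")
          case True
          then have "norm (evolution S \<eta> r s) \<le> M"
            using evolution_on_interval[OF k(1) sr(2) True] norm_S[OF mode_in] sr by simp
          also have "M \<le> M\<^sup>2" using M by (simp add: self_le_power)
          finally show ?thesis .
        next
          case False
          let ?q = "t (Suc k)"
          have "r \<le> t (Suc (Suc k))" using dwell[of "Suc k"] k sr by simp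
          then have "evolution S \<eta> r ?q = S (\<eta> ?q) (r - ?q)"
            using evolution_on_interval[of "Suc k" ?q r] False by simp
          moreover have "evolution S \<eta> ?q s = S (\<eta> (t k)) (?q - s)"
            using evolution_on_interval[of k s ?q] k by simp
          moreover have "evolution S \<eta> r s = evolution S \<eta> r ?q o\<^sub>L evolution S \<eta> ?q s"
            using sr k False by (intro evolution_cocycle) auto
          ultimately have "norm (evolution S \<eta> r s) \<le> norm (S (\<eta> ?q) (r - ?q)) * norm (S (\<eta> (t k)) (?q - s))"
            by (simp add: norm_blinfun_compose)
          also have "\<dots> \<le> M * M"
            using M k sr False by (intro mult_mono norm_S mode_in) auto
          finally show ?thesis by (simp add: power2_eq_square)
        qed
      qed
    qed
    show ?thesis using exponential_decay[OF sr] by (simp add: \<omega>_def)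
  qed
  have "\<forall>\<eta>\<in>Sigma_min N T. \<forall>s r. 0 \<le> s \<and> s \<le> r \<longrightarrow> norm (evolution S \<eta> r s) \<le>
      2 * sqrt (gain c_P a (M\<^sup>2) T) * 1 ^ num_switches \<eta> r s * exp (- \<omega> * (r - s))"
    using decay by simp
  moreover have "1 \<le> 2 * sqrt (gain c_P a (M\<^sup>2) T)"
    using gain real_sqrt_ge_one[of "gain c_P a (M\<^sup>2) T"] by linarith
  moreover have "0 \<le> \<omega>" "0 < \<omega> - ln 1" using \<omega> by simp_all
  ultimately show ?thesis
    unfolding UGES_def
    by (intro exI[of _ "2 * sqrt (gain c_P a (M\<^sup>2) T)"] exI[of _ \<omega>] exI[of _ "1 :: real"]) simp
qed

end
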